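(* Let $N=\{1,\dots,n\}$, $\mathbf{q}\in\mathbb{R}^n_+$ with $1>q_1\ge q_2\ge\dots\ge q_n$, and consider the continuous mixing set $\mathcal{P}^{\mathrm{CMIX}}=\{(w,\mathbf{y},\mathbf{x})\in\mathbb{R}\times\mathbb{R}^n_+\times\mathbb{Z}^n:w+x_i+y_i\ge q_i\ \forall i\in N\}$. Let $C$ be an elementary cycle of the digraph $G=(N,A)$ (defined in the context) whose nodes $i\in N(C)$ have pairwise distinct values $q_i$. Then the (facet-defining) cycle inequality associated with $C$ is identical to an MISEPI for $\mathcal{P}^{\mathrm{CMIX}}$, as follows. (1) If $C=\{(j,j)\}$ is a self-loop, it is the MISEPI associated with $(u_0,\mathbf{u})=(1,\mathbf{1}^{j})$ and any $\mathbf{p}\in\mathbb{Z}^n$ and any permutation $\boldsymbol\delta$ of $N$. (2) If $|N(C)|\ge2$, it is the MISEPI associated with $u_0=|L(C)|$, $\mathbf{u}=\mathbf{1}^{N(C)}$, the vector $\mathbf{p}\in\mathbb{Z}^n$ with $p_j=-1$ for $j\in L(C)$, $p_j=0$ for $j\in N(C)\setminus L(C)$, $p_j=2$ for $j\in N\setminus N(C)$, and any permutation $\boldsymbol\delta$ of $N$ with $\delta(i)=N_C^-(N(C)_i)$ for $i=1,\dots,|N(C)|$ (the remaining elements $N\setminus N(C)$ being placed in arbitrary order).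
   Context: $A=\{(j,k)\in N\times N:q_j\ne q_k\}\cup\{(j,j):j\in N\}$. For $(j,k)\in A$ with $q_j\ne q_k$: $\phi_{jk}(w,\mathbf{y},\mathbf{x})=w+y_j-[q_k+(q_k-q_j-1)x_j]$ if $q_j<q_k$, and $\phi_{jk}(w,\mathbf{y},\mathbf{x})=y_j-(q_k-q_j)x_j$ if $q_j>q_k$. For self-loops, $\phi_{jj}(w,\mathbf{y},\mathbf{x})=w+y_j-(q_j-x_j)$. An elementary cycle $C\subseteq A$ is a directed cycle visiting each of its nodes exactly once (a self-loop is an elementary cycle); its cycle inequality is $\sum_{(j,k)\in C}\phi_{jk}(w,\mathbf{y},\mathbf{x})\ge0$. $N(C)$ is the set of nodes of $C$; $L(C)=\{j\in N(C):(j,k)\in C,\ q_j<q_k\}$; $N(C)_1,\dots,N(C)_{|N(C)|}$ are the elements of $N(C)$ labelled so that $q_{N(C)_1}>\dots>q_{N(C)_{|N(C)|}}$; $N_C^-(i)$ is the in-neighbor of $i$ in $C$, i.e. $(N_C^-(i),i)\in C$. Let $h^i(\mathbf{x})=q_i-x_i$ and, for $(u_0,\mathbf{u})\in\mathbb{R}^{n+1}_+$ with $u_0\le\sum_{i}u_i$, let $F_{u_0,\mathbf{u}}(\mathbf{x})=\min_{j\in N}\{u_0h^j(\mathbf{x})+\sum_{i\in N}u_i\max\{0,h^i(\mathbf{x})-h^j(\mathbf{x})\}\}$ for $\mathbf{x}\in\mathbb{Z}^n$. The MISEPI associated with $(u_0,\mathbf{u})$, $\mathbf{p}\in\mathbb{Z}^n$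 and a permutation $\boldsymbol\delta$ of $N$ is $$u_0w+\mathbf{u}^\top\mathbf{y}\ge F_{u_0,\mathbf{u}}(\mathbf{p}^0)+\sum_{i=1}^n[F_{u_0,\mathbf{u}}(\mathbf{p}^i)-F_{u_0,\mathbf{u}}(\mathbf{p}^{i-1})](x_{\delta(i)}-p_{\delta(i)}),\qquad \mathbf{p}^i=\mathbf{p}+\sum_{j=1}^i\mathbf{1}^{\delta(j)}.$$ $\mathbf{1}^S$ is the indicator vector of $S\subseteq N$ and $\mathbf{1}^j=\mathbf{1}^{\{j\}}$. *)

theory Defs
  imports "HOL-Analysis.Analysis" "Graph_Theory.Pair_Digraph"
begin

text \<open>The index set \<open>N = {1, \<dots>, n}\<close> is the finite index type \<open>'n\<close>, so \<open>n = CARD('n)\<close>.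
  A point \<open>(w, y, x)\<close> is an element of the Euclidean space
  \<open>real \<times> real ^ 'n \<times> real ^ 'n\<close>.\<close>

type_synonym 'n point = "real \<times> (real ^ 'n) \<times> (real ^ 'n)"

definition cmix :: "real ^ 'n \<Rightarrow> 'n point set" where
  "cmix q = {(w, y, x). (\<forall>i. 0 \<le> y $ i) \<and> (\<forall>i. x $ i \<in> \<int>) \<and>
                        (\<forall>i. q $ i \<le> w + x $ i + y $ i)}"

definition indicator_vec :: "'n set \<Rightarrow> 'a::zero_neq_one ^ 'n" where
  "indicator_vec S = (\<chi> i. of_bool (i \<in> S))"


text \<open>A linear inequality \<open>l \<ge> r\<close> is the pair \<open>(l, r)\<close> of its two (affine) sides.
  Two of them are the same inequality if they agree once all terms are moved to one side,
  i.e. if they have the same coefficients and the same constant term; no rescaling is allowed.\<close>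

type_synonym 'n ineq = "('n point \<Rightarrow> real) \<times> ('n point \<Rightarrow> real)"

definition same_ineq :: "'n ineq \<Rightarrow> 'n ineq \<Rightarrow> bool" where
  "same_ineq a b \<longleftrightarrow> (\<forall>v. fst a v - snd a v = fst b v - snd b v)"

definition facet_defining :: "'n::finite ineq \<Rightarrow> 'n point set \<Rightarrow> bool" where
  "facet_defining a S \<longleftrightarrow>
     (\<forall>v \<in> S. fst a v \<ge> snd a v) \<and> {v \<in> S. fst a v = snd a v} facet_of S"


definition cmix_digraph :: "real ^ 'n \<Rightarrow> 'n pair_pre_digraph" where
  "cmix_digraph q =
     \<lparr>pverts = UNIV, parcs = {(j, k). q $ j \<noteq> q $ k} \<union> {(j, j) |j. True}\<rparr>"

text \<open>The library's cycles are closed walks, given as lists of arcs, in which no vertex is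
  repeated except for the coincidence of the first and last one; self-loops are included.
  Here a cycle is identified with its set of arcs.\<close>

definition elementary_cycle :: "real ^ 'n \<Rightarrow> ('n \<times> 'n) set \<Rightarrow> bool" where
  "elementary_cycle q C \<longleftrightarrow>
     (\<exists>c. pre_digraph.cycle (with_proj (cmix_digraph q)) c \<and> set c = C)"

definition phi :: "real ^ 'n \<Rightarrow> 'n \<Rightarrow> 'n \<Rightarrow> 'n point \<Rightarrow> real" where
  "phi q j k = (\<lambda>(w, y, x).
     if j = k then w + y $ j - (q $ j - x $ j)
     else if q $ j < q $ k then w + y $ j - (q $ k + (q $ k - q $ j - 1) * x $ j)
     else y $ j - (q $ k - q $ j) * x $ j)"

definition cycle_ineq :: "real ^ 'n \<Rightarrow> ('n \<times> 'n) set \<Rightarrow> 'n ineq" where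
  "cycle_ineq q C = ((\<lambda>v. \<Sum>(j, k) \<in> C. phi q j k v), (\<lambda>v. 0))"

definition nodes :: "('n \<times> 'n) set \<Rightarrow> 'n set" where
  "nodes C = fst ` C \<union> snd ` C"

definition ascent_nodes :: "real ^ 'n \<Rightarrow> ('n \<times> 'n) set \<Rightarrow> 'n set" where
  "ascent_nodes q C = {j \<in> nodes C. \<exists>k. (j, k) \<in> C \<and> q $ j < q $ k}"

definition in_nbr :: "('n \<times> 'n) set \<Rightarrow> 'n \<Rightarrow> 'n" where
  "in_nbr C i = (THE j. (j, i) \<in> C)"

text \<open>\<open>\<nu> 1, \<dots>, \<nu> |S|\<close> enumerates \<open>S\<close> in strictly decreasing order of \<open>q\<close>.\<close>

definition decreasing_labelling :: "real ^ 'n \<Rightarrow> 'n set \<Rightarrow> (nat \<Rightarrow> 'n) \<Rightarrow> bool" where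
  "decreasing_labelling q S \<nu> \<longleftrightarrow> bij_betw \<nu> {1..card S} S \<and>
     (\<forall>a \<in> {1..card S}. \<forall>b \<in> {1..card S}. a < b \<longrightarrow> q $ \<nu> a > q $ \<nu> b)"

definition permutation_of_N :: "(nat \<Rightarrow> 'n) \<Rightarrow> bool" where
  "permutation_of_N \<delta> \<longleftrightarrow> bij_betw \<delta> {1..CARD('n)} UNIV"

definition cycle_permutation :: "real ^ 'n \<Rightarrow> ('n \<times> 'n) set \<Rightarrow> (nat \<Rightarrow> 'n) \<Rightarrow> bool" where
  "cycle_permutation q C \<delta> \<longleftrightarrow> permutation_of_N \<delta> \<and>
     (\<exists>\<nu>. decreasing_labelling q (nodes C) \<nu> \<and>
          (\<forall>i \<in> {1..card (nodes C)}. \<delta> i = in_nbr C (\<nu> i)))"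


definition h_fn :: "real ^ 'n \<Rightarrow> 'n \<Rightarrow> int ^ 'n \<Rightarrow> real" where
  "h_fn q i x = q $ i - of_int (x $ i)"

definition F_fn :: "real ^ 'n \<Rightarrow> real \<Rightarrow> real ^ 'n \<Rightarrow> int ^ 'n \<Rightarrow> real" where
  "F_fn q u0 u x =
     Min (range (\<lambda>j. u0 * h_fn q j x + (\<Sum>i\<in>UNIV. u $ i * max 0 (h_fn q i x - h_fn q j x))))"

definition misepi_weights :: "real \<Rightarrow> real ^ 'n \<Rightarrow> bool" where
  "misepi_weights u0 u \<longleftrightarrow> 0 \<le> u0 \<and> (\<forall>i. 0 \<le> u $ i) \<and> u0 \<le> (\<Sum>i\<in>UNIV. u $ i)"

definition partial_point :: "int ^ 'n \<Rightarrow> (nat \<Rightarrow> 'n) \<Rightarrow> nat \<Rightarrow> int ^ 'n" where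
  "partial_point p \<delta> i = p + (\<Sum>j = 1..i. indicator_vec {\<delta> j})"

definition misepi :: "real ^ 'n \<Rightarrow> real \<Rightarrow> real ^ 'n \<Rightarrow> int ^ 'n \<Rightarrow> (nat \<Rightarrow> 'n) \<Rightarrow> 'n ineq" where
  "misepi q u0 u p \<delta> =
     ((\<lambda>(w, y, x). u0 * w + (\<Sum>i\<in>UNIV. u $ i * y $ i)),
      (\<lambda>(w, y, x). F_fn q u0 u (partial_point p \<delta> 0) +
         (\<Sum>i = 1..CARD('n).
            (F_fn q u0 u (partial_point p \<delta> i) - F_fn q u0 u (partial_point p \<delta> (i - 1))) *
            (x $ \<delta> i - of_int (p $ \<delta> i)))))"

definition is_misepi :: "real ^ 'n \<Rightarrow> 'n ineq \<Rightarrow> bool" where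
  "is_misepi q a \<longleftrightarrow> (\<exists>u0 u p \<delta>. misepi_weights u0 u \<and> permutation_of_N \<delta> \<and>
                                  a = misepi q u0 u p \<delta>)"

end

theory Submission
  imports Defs
begin

text \<open>
  For \<open>0 \<le> w < 1\<close> and integral \<open>x\<close> every arc satisfies
  \<open>\<phi>\<^sub>j\<^sub>k \<ge> max q\<^sub>j w - max q\<^sub>k w\<close>, and the shift \<open>(w, x) \<mapsto> (w - 1, x + 1)\<close> changes \<open>\<phi>\<^sub>j\<^sub>k\<close> by a
  difference \<open>q\<^sub>j - q\<^sub>k\<close>; both telescope around a cycle, so the cycle inequality is valid.
  It is tight at the points with \<open>y\<close> minimal in which \<open>x\<^sub>j\<close> is one of two consecutive integers,
  chosen according to the position of \<open>w\<close> relative to \<open>q\<^sub>k\<close>, where \<open>k\<close> is the successor of \<open>j\<close>;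
  at \<open>w = q\<^sub>k\<close> both choices are allowed.

  Since \<open>F (x)\<close> is the minimum of \<open>u\<^sub>0 w + u \<bullet> y\<close> over the fibre above \<open>x\<close>, attained at some
  \<open>w = h\<^sup>j (x)\<close>, validity together with one tight point above \<open>p\<^sup>i\<close> shows that \<open>F (p\<^sup>i)\<close> is the value
  at \<open>p\<^sup>i\<close> of the affine function of \<open>x\<close> in the cycle inequality. This holds for all \<open>i\<close>, and the
  right-hand side of the MISEPI is the affine interpolant of these values.

  For the facet property, a linear functional constant on the tight points is examined near
  \<open>w = q\<^sub>k\<close> for each arc \<open>(j, k)\<close>: moving \<open>w\<close> up before and down after switching \<open>x\<^sub>j\<close> shows that
  its coefficients of \<open>y\<^sub>j\<close> and \<open>y\<^sub>k\<close> agree.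
\<close>

section \<open>A facet criterion for convex hulls\<close>

text \<open>A vector orthogonal to all directions of the face is a functional constant on the tight
  generators, so \<open>unique\<close> confines the orthogonal complement to a line. Hence the face
  has dimension at least \<open>DIM('a) - 1\<close>, while \<open>vs\<close> makes it proper and
  \<open>vt\<close> nonempty.\<close>

lemma facet_of_hullI:
  fixes a :: "'a::euclidean_space"
  assumes valid: "\<And>v. v \<in> S \<Longrightarrow> b \<le> a \<bullet> v"
    and vt: "vt \<in> S" "a \<bullet> vt = b"
    and vs: "vs \<in> S" "a \<bullet> vs \<noteq> b"
    and unique: "\<And>c. (\<And>v. v \<in> S \<Longrightarrow> a \<bullet> v = b \<Longrightarrow> c \<bullet> v = c \<bullet> vt) \<Longrightarrow> \<exists>l. c = l *\<^sub>R a"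
  shows "(convex hull S \<inter> {v. a \<bullet> v = b}) facet_of (convex hull S)"
proof -
  let ?H = "convex hull S" and ?T = "convex hull S \<inter> {v. a \<bullet> v = b}"
  have sub: "?H \<subseteq> {v. b \<le> a \<bullet> v}"
    by (rule hull_minimal) (use valid in \<open>auto intro: convex_halfspace_ge\<close>)
  have face: "?T face_of ?H"
    using sub by (intro face_of_Int_supporting_hyperplane_ge) auto
  have vtT: "vt \<in> ?T" and vsH: "vs \<in> ?H"
    using vt vs by (auto intro: hull_inc)
  let ?D = "(\<lambda>v. v - vt) ` ?T"
  let ?O = "{c \<in> UNIV. \<forall>d\<in>span ?D. orthogonal d c}"
  have "c \<in> span {a}" if "c \<in> ?O" for c
  proof -
    have "c \<bullet> v = c \<bullet> vt" if "v \<in> S" "a \<bullet> v = b" for v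
    proof -
      have "v - vt \<in> span ?D"
        using that by (intro span_base imageI) (auto intro: hull_inc)
      then have "orthogonal (v - vt) c"
        using \<open>c \<in> ?O\<close> by blast
      then show ?thesis
        by (simp add: orthogonal_def inner_diff_right inner_commute[of _ c])
    qed
    then obtain l where "c = l *\<^sub>R a"
      using unique by blast
    then show ?thesis
      by (simp add: span_base span_scale)
  qed
  then have "dim ?O \<le> dim (span {a})"
    by (intro dim_subset) auto
  also have "\<dots> \<le> 1"
    by (simp add: dim_singleton)
  finally have "dim ?O \<le> 1" .
  moreover have "dim ?O + dim (span ?D) = DIM('a)"
    using dim_subspace_orthogonal_to_vectors[of "span ?D" UNIV] by simp
  ultimately have "DIM('a) \<le> dim ?D + 1"
    by simp
  moreover have "aff_dim ?T = int (dim ?D)"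
    using vtT by (intro aff_dim_eq_dim_subtract) (auto intro: hull_inc)
  moreover have "aff_dim ?T < aff_dim ?H"
    using face vsH vs(2) by (intro face_of_aff_dim_lt) auto
  moreover have "aff_dim ?H \<le> int DIM('a)"
    by (rule aff_dim_le_DIM)
  ultimately have "aff_dim ?T = aff_dim ?H - 1"
    by linarith
  with face vtT show ?thesis
    unfolding facet_of_def by auto
qed

section \<open>Estimates for a single arc\<close>

text \<open>With this step function a self-loop and an ascending arc obey the same formula, see \<open>phi_eq\<close>.\<close>

definition climb :: "real ^ 'n \<Rightarrow> 'n \<Rightarrow> 'n \<Rightarrow> real" where
  "climb q j k = of_bool (q $ j \<le> q $ k)"

lemma phi_eq:
  assumes "j = k \<or> q $ j \<noteq> q $ k"
  shows "phi q j k (w, y, x) =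
    climb q j k * (w - q $ k) + y $ j - (q $ k - q $ j - climb q j k) * x $ j"
  using assms by (auto simp: phi_def climb_def algebra_simps)

text \<open>The contributions of \<open>climb\<close> to the coefficients of w and of
  \<open>x $ j\<close> are equal and cancel, leaving a difference of values of q.\<close>

lemma phi_shift:
  assumes "j = k \<or> q $ j \<noteq> q $ k"
  shows "phi q j k (w, y, x) =
    phi q j k (w - m, y, x + (\<chi> i. m)) + m * (q $ k - q $ j)"
  by (simp add: phi_eq[OF assms] algebra_simps)

text \<open>Once \<open>y $ j\<close> is replaced by its least feasible value, \<open>phi\<close> is
  convex in \<open>x $ j\<close>, and for w in [0,1) its integer minimum lies in {-1, 0, 1}.\<close>

lemma phi_ge_potential:
  fixes q :: "real ^ 'n"
  assumes arc: "j = k \<or> q $ j \<noteq> q $ k"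
    and q: "0 \<le> q $ j" "q $ j < 1" "0 \<le> q $ k" "q $ k < 1"
    and w: "0 \<le> w" "w < 1"
    and v: "x $ j \<in> \<int>" "0 \<le> y $ j" "q $ j \<le> w + x $ j + y $ j"
  shows "max (q $ j) w - max (q $ k) w \<le> phi q j k (w, y, x)"
proof -
  obtain z :: int where z: "x $ j = of_int z"
    using v(1) by (auto elim: Ints_cases)
  define d where "d = q $ k - q $ j"
  consider "z \<le> -1" | "z = 0" | "z \<ge> 1" by linarith
  then show ?thesis
  proof cases
    case 1
    then have z1: "x $ j \<le> -1"
      by (simp add: z)
    \<comment> \<open>With \<open>y $ j\<close> at its bound \<open>q $ j - w - x $ j\<close>, the
      slope in \<open>x $ j\<close> is \<open>-(1 + d)\<close>, or \<open>-d\<close> for an ascent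
      or a loop; the products reduce this range to \<open>x $ j = -1\<close>.\<close>
    have "0 \<le> (1 + d) * (- 1 - x $ j)"
      using q z1 by (auto simp: d_def intro!: mult_nonneg_nonneg)
    moreover have "0 \<le> d * (- 1 - x $ j)" if "q $ j \<le> q $ k"
      using that z1 unfolding d_def by (intro mult_nonneg_nonneg) auto
    ultimately show ?thesis using z1
      using q w v unfolding phi_eq[OF arc] climb_def d_def
      by (cases "q $ j \<le> q $ k") (auto simp: algebra_simps max_def)
  next
    case 2
    then have "x $ j = 0" by (simp add: z)
    then show ?thesis
      using q w v unfolding phi_eq[OF arc] climb_def
      by (cases "q $ j \<le> q $ k") (auto simp: algebra_simps max_def)
  next
    case 3
    then have z1: "1 \<le> x $ j"
      by (simp add: z)
    \<comment> \<open>Now the bound on \<open>y $ j\<close> is 0 and the slope is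
      \<open>1 - d\<close> for an ascent or a loop and \<open>-d\<close> for a descent; this reduces
      to \<open>x $ j = 1\<close>.\<close>
    have "0 \<le> (1 - d) * (x $ j - 1)"
      using q z1 by (auto simp: d_def intro!: mult_nonneg_nonneg)
    moreover have "0 \<le> - d * (x $ j - 1)" if "q $ k < q $ j"
      using that z1 unfolding d_def by (intro mult_nonneg_nonneg) auto
    ultimately show ?thesis using z1
      using q w v unfolding phi_eq[OF arc] climb_def d_def
      by (cases "q $ j \<le> q $ k") (auto simp: algebra_simps max_def)
  qed
qed

definition lowest_point :: "real ^ 'n \<Rightarrow> real \<Rightarrow> int ^ 'n \<Rightarrow> 'n point" where
  "lowest_point q w x = (w, (\<chi> i. max 0 (q $ i - of_int (x $ i) - w)), (\<chi> i. of_int (x $ i)))"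

lemma lowest_point_in_cmix: "lowest_point q w x \<in> cmix q"
  by (auto simp: lowest_point_def cmix_def max_def)

text \<open>The equality case of the potential bound. The limits on w settle the sign of
  \<open>q $ j - x $ j - w\<close> when \<open>x $ j\<close> is -1 or 1; they leave room to move w
  slightly below 0.\<close>

lemma phi_lowest_point:
  fixes q :: "real ^ 'n"
  assumes arc: "j = k \<or> q $ j \<noteq> q $ k"
    and w: "q $ j - 1 \<le> w" "w \<le> q $ j + 1"
    and x: "of_int (x $ j) = - climb q j k \<and> q $ k \<le> w \<or>
            of_int (x $ j) = 1 - climb q j k \<and> w \<le> q $ k"
  shows "phi q j k (lowest_point q w x) = max (q $ j) w - max (q $ k) w"
  using w x unfolding lowest_point_def phi_eq[OF arc] climb_def
  by (cases "q $ j \<le> q $ k") (auto simp: algebra_simps max_def)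

section \<open>From closed walks to cyclic permutations of the nodes\<close>

text \<open>For a closed walk the two endpoints cancel, so tails and heads agree with multiplicity;
  this transfers distinctness from heads to tails.\<close>

lemma pcas_mset_endpoints:
  assumes "pcas u c v"
  shows "add_mset v (mset (map fst c)) = add_mset u (mset (map snd c))"
  using assms by (induction c arbitrary: u) (auto simp: add_mset_commute)

lemma pcas_const_along:
  assumes "pcas u c v" and "\<And>j k. (j, k) \<in> set c \<Longrightarrow> f j = f k" and "a \<in> set c"
  shows "f (fst a) = f u"
  using assms by (induction c arbitrary: u) (auto, metis)

text \<open>Injective tails and heads with equal images make \<open>C\<close> a permutation of its
  nodes; \<open>const_along\<close> says that there is a single orbit, in the form in which
  connectivity is applied to coefficients and indicators.\<close>

locale node_cycle =
  fixes q :: "real ^ 'n::finite" and C :: "('n \<times> 'n) set"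
  assumes q_nonneg: "0 \<le> q $ i" and q_less_1: "q $ i < 1"
    and inj_tail: "inj_on fst C" and inj_head: "inj_on snd C"
    and heads_eq_tails: "snd ` C = fst ` C"
    and nonempty: "C \<noteq> {}"
    and const_along: "(\<And>j k. (j, k) \<in> C \<Longrightarrow> (f :: 'n \<Rightarrow> real) j = f k) \<Longrightarrow>
      i \<in> fst ` C \<Longrightarrow> i' \<in> fst ` C \<Longrightarrow> f i = f i'"
    and inj_q: "inj_on (\<lambda>i. q $ i) (nodes C)"

lemma elementary_cycle_node_cycle:
  fixes q :: "real ^ 'n::finite"
  assumes "\<And>i. 0 \<le> q $ i" "\<And>i. q $ i < 1"
    and C: "elementary_cycle q C" and inj: "inj_on (\<lambda>i. q $ i) (nodes C)"
  shows "node_cycle q C"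
proof -
  obtain c u where c: "pcas u c u" "distinct (tl (pawalk_verts u c))" "c \<noteq> []" "set c = C"
    using C unfolding elementary_cycle_def pre_digraph.cycle_def pre_digraph.awalk_def
      cas_with_proj_eq awalk_verts_with_proj_eq by blast
  have "pawalk_verts v c' = v # map snd c'" if "pcas v c' v'" for v c' v'
    using that by (induction c' arbitrary: v) auto
  then have snd_c: "distinct (map snd c)"
    using c(2) unfolding \<open>\<And>v c' v'. pcas v c' v' \<Longrightarrow> _\<close>[OF c(1)] by simp
  have mset: "mset (map fst c) = mset (map snd c)"
    using pcas_mset_endpoints[OF c(1)] by simp
  then have fst_c: "distinct (map fst c)"
    using snd_c mset_eq_imp_distinct_iff by blast
  have "snd ` C = fst ` C"
    using mset_eq_setD[OF mset] c(4) by simp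
  moreover have "f i = f i'" if "\<And>j k. (j, k) \<in> C \<Longrightarrow> f j = f k" "i \<in> fst ` C" "i' \<in> fst ` C"
    for f :: "'n \<Rightarrow> real" and i i'
    using that pcas_const_along[OF c(1), of f] c(4) by (metis (no_types, lifting) imageE)
  ultimately show ?thesis
    using assms fst_c snd_c c(3,4) by unfold_locales (auto simp: distinct_map)
qed

context node_cycle
begin

lemma nodes_eq: "nodes C = fst ` C"
  unfolding nodes_def heads_eq_tails by simp

lemma in_nodes: "(j, k) \<in> C \<Longrightarrow> j \<in> nodes C" "(j, k) \<in> C \<Longrightarrow> k \<in> nodes C"
  unfolding nodes_def by force+

lemma arc_cases: "(j, k) \<in> C \<Longrightarrow> j = k \<or> q $ j \<noteq> q $ k"
  using inj_q in_nodes by (meson inj_onD)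

lemma tail_unique: "(j, k) \<in> C \<Longrightarrow> (j, k') \<in> C \<Longrightarrow> k = k'"
  using inj_onD[OF inj_tail, of "(j, k)" "(j, k')"] by simp

lemma head_unique: "(j, k) \<in> C \<Longrightarrow> (j', k) \<in> C \<Longrightarrow> j = j'"
  using inj_onD[OF inj_head, of "(j, k)" "(j', k)"] by simp

lemma sum_tails: "(\<Sum>(j, k)\<in>C. f j) = (\<Sum>j\<in>nodes C. f j)"
  unfolding nodes_eq sum.reindex[OF inj_tail] by (simp add: case_prod_beta)

lemma sum_heads: "(\<Sum>(j, k)\<in>C. f k) = (\<Sum>j\<in>nodes C. f j)"
  unfolding nodes_eq heads_eq_tails[symmetric] sum.reindex[OF inj_head] by (simp add: case_prod_beta)

lemma sum_telescope: "(\<Sum>(j, k)\<in>C. f j - f k :: real) = 0"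
proof -
  have "(\<Sum>(j, k)\<in>C. f j - f k) = (\<Sum>(j, k)\<in>C. f j) - (\<Sum>(j, k)\<in>C. f k)"
    unfolding case_prod_beta by (rule sum_subtractf)
  then show ?thesis
    unfolding sum_tails sum_heads by simp
qed

definition succ :: "'n \<Rightarrow> 'n" where
  "succ j = (THE k. (j, k) \<in> C)"

lemma succ_eq: "(j, k) \<in> C \<Longrightarrow> succ j = k"
  unfolding succ_def using tail_unique by blast

lemma succ_arc: "j \<in> nodes C \<Longrightarrow> (j, succ j) \<in> C"
  unfolding nodes_eq using succ_eq by fastforce

text \<open>The only in- and out-neighbour of j is j itself, so the indicator of j is constant along
  arcs and therefore equal to 1 on all nodes.\<close>

lemma loop_imp_singleton:
  assumes "(j, j) \<in> C"
  shows "C = {(j, j)}"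
proof -
  have "i = j" if "i \<in> nodes C" for i
  proof -
    have "of_bool (k = j) = (of_bool (k' = j) :: real)" if "(k, k') \<in> C" for k k'
    proof -
      have "k = j \<longleftrightarrow> k' = j"
        using that assms head_unique tail_unique by blast
      then show ?thesis by simp
    qed
    then have "of_bool (i = j) = (of_bool (j = j) :: real)"
      using that in_nodes(1)[OF assms] unfolding nodes_eq by (rule const_along)
    then show ?thesis
      by (simp split: if_splits)
  qed
  then have "a = j \<and> b = j" if "(a, b) \<in> C" for a b
    using that in_nodes by blast
  then have "C \<subseteq> {(j, j)}"
    by (intro subrelI) blast
  with assms show ?thesis by blast
qed

section \<open>Validity and tight points\<close>

definition cyc :: "'n point \<Rightarrow> real" where
  "cyc v = (\<Sum>(j, k)\<in>C. phi q j k v)"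

lemma cyc_nonneg:
  assumes "v \<in> cmix q"
  shows "0 \<le> cyc v"
proof -
  obtain w y x where v: "v = (w, y, x)"
    by (cases v)
  define m w' x' where "m = (of_int \<lfloor>w\<rfloor> :: real)" and "w' = w - m" and "x' = x + (\<chi> i. m)"
  have w': "0 \<le> w'" "w' < 1"
    unfolding w'_def m_def by linarith+
  \<comment> \<open>The term \<open>- m * q $ j\<close> absorbs the correction from shifting w by
    its integer part, so a single potential covers both effects.\<close>
  define \<pi> where "\<pi> j = max (q $ j) w' - m * q $ j" for j
  have "\<pi> j - \<pi> k \<le> phi q j k v" if "(j, k) \<in> C" for j k
  proof -
    have "max (q $ j) w' - max (q $ k) w' \<le> phi q j k (w', y, x')"
      using assms w' q_nonneg q_less_1 arc_cases[OF that]
      by (intro phi_ge_potential) (auto simp: v cmix_def w'_def x'_def m_def)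
    then show ?thesis
      unfolding v phi_shift[OF arc_cases[OF that], of w y x m] \<pi>_def w'_def x'_def
      by (simp add: algebra_simps)
  qed
  then have "(\<Sum>(j, k)\<in>C. \<pi> j - \<pi> k) \<le> cyc v"
    unfolding cyc_def by (intro sum_mono) auto
  then show ?thesis
    by (simp add: sum_telescope)
qed

definition tight_at :: "real \<Rightarrow> int ^ 'n \<Rightarrow> bool" where
  "tight_at w x \<longleftrightarrow> (\<forall>(j, k)\<in>C. q $ j - 1 \<le> w \<and> w \<le> q $ j + 1 \<and>
     (of_int (x $ j) = - climb q j k \<and> q $ k \<le> w \<or>
      of_int (x $ j) = 1 - climb q j k \<and> w \<le> q $ k))"

lemma cyc_lowest_point:
  assumes "tight_at w x"
  shows "cyc (lowest_point q w x) = 0"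
proof -
  have "cyc (lowest_point q w x) = (\<Sum>(j, k)\<in>C. max (q $ j) w - max (q $ k) w)"
    unfolding cyc_def
    using assms arc_cases by (intro sum.cong) (auto simp: tight_at_def intro!: phi_lowest_point)
  then show ?thesis
    by (simp add: sum_telescope)
qed

section \<open>The cycle inequality as a linear form\<close>

definition coef_x :: "'n \<Rightarrow> real" where
  "coef_x i = (if i \<in> nodes C then q $ succ i - q $ i - climb q i (succ i) else 0)"

definition coef_w :: real where
  "coef_w = (\<Sum>(j, k)\<in>C. climb q j k)"

definition const :: real where
  "const = (\<Sum>(j, k)\<in>C. climb q j k * q $ k)"

definition normal :: "'n point" where
  "normal = (coef_w, indicator_vec (nodes C), (\<chi> i. - coef_x i))"

definition lin :: "real ^ 'n \<Rightarrow> real" where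
  "lin x = const + (\<Sum>i\<in>UNIV. coef_x i * x $ i)"

lemma cyc_eq_lin:
  "cyc (w, y, x) = coef_w * w + (\<Sum>i\<in>UNIV. indicator_vec (nodes C) $ i * y $ i) - lin x"
proof -
  have "cyc (w, y, x) = (\<Sum>(j, k)\<in>C. climb q j k * w + y $ j - coef_x j * x $ j - climb q j k * q $ k)"
    unfolding cyc_def
  proof (intro sum.cong refl, clarify)
    fix j k assume jk: "(j, k) \<in> C"
    have coef: "coef_x j = q $ k - q $ j - climb q j k"
      by (simp add: coef_x_def succ_eq[OF jk] in_nodes(1)[OF jk])
    then show "phi q j k (w, y, x) =
        climb q j k * w + y $ j - coef_x j * x $ j - climb q j k * q $ k"
      unfolding phi_eq[OF arc_cases[OF jk]] coef by (simp add: algebra_simps)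
  qed
  also have "\<dots> = coef_w * w + (\<Sum>(j, k)\<in>C. y $ j) - (\<Sum>(j, k)\<in>C. coef_x j * x $ j) - const"
    unfolding coef_w_def const_def
    by (simp add: case_prod_beta sum.distrib sum_subtractf sum_distrib_right)
  also have "(\<Sum>(j, k)\<in>C. y $ j) = (\<Sum>i\<in>UNIV. indicator_vec (nodes C) $ i * y $ i)"
    unfolding sum_tails by (rule sum.mono_neutral_cong_left) (auto simp: indicator_vec_def)
  also have "(\<Sum>(j, k)\<in>C. coef_x j * x $ j) = (\<Sum>i\<in>UNIV. coef_x i * x $ i)"
    unfolding sum_tails by (rule sum.mono_neutral_left) (auto simp: coef_x_def)
  finally show ?thesis
    by (simp add: lin_def)
qed

lemma cyc_eq_inner: "cyc v = normal \<bullet> v - const"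
  by (cases v) (simp add: cyc_eq_lin normal_def lin_def inner_vec_def sum_negf)

lemma lowest_point_inner:
  "c \<bullet> lowest_point q w x = fst c * w + (\<Sum>i\<in>UNIV. fst (snd c) $ i * max 0 (q $ i - of_int (x $ i) - w))
    + (\<Sum>i\<in>UNIV. snd (snd c) $ i * of_int (x $ i))"
  by (cases c) (simp add: lowest_point_def inner_vec_def)

section \<open>Functionals constant on tight points, and the facet property\<close>

text \<open>The threshold \<open>t\<close> is kept apart from w so that one integer vector serves a
  whole interval of values of w.\<close>

definition tight_x :: "real \<Rightarrow> int ^ 'n" where
  "tight_x t = (\<chi> i. if i \<in> nodes C
     then of_bool (t < q $ succ i) - of_bool (q $ i \<le> q $ succ i) else 0)"

lemma tight_x_range: "tight_x t $ i \<in> {-1, 0, 1}"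
  by (auto simp: tight_x_def)

lemma tight_x_arc:
  "(j, k) \<in> C \<Longrightarrow> of_int (tight_x t $ j) = of_bool (t < q $ k) - climb q j k"
  by (simp add: tight_x_def climb_def succ_eq in_nodes(1))

lemma tight_at_tight_x:
  assumes "\<And>j. q $ j - 1 \<le> w" "\<And>j. w \<le> q $ j + 1"
    and "\<And>j k. (j, k) \<in> C \<Longrightarrow> t < q $ k \<Longrightarrow> w \<le> q $ k"
    and "\<And>j k. (j, k) \<in> C \<Longrightarrow> q $ k \<le> t \<Longrightarrow> q $ k \<le> w"
  shows "tight_at w (tight_x t)"
  using assms by (fastforce simp: tight_at_def tight_x_arc not_less)

text \<open>For \<open>x $ i\<close> in {-1, 0, 1} the numbers \<open>q $ i - z\<close> are the
  breakpoints in w of \<open>max 0 (q $ i - x $ i - w)\<close>. Moving w by at most \<epsilon> away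
  from \<open>q $ k\<close> thus passes no further breakpoint.\<close>

lemma separation:
  obtains \<epsilon> where "0 < \<epsilon>"
    "\<And>i k z. z \<in> {-1, 0, 1} \<Longrightarrow> q $ i - z \<noteq> q $ k \<Longrightarrow> \<epsilon> \<le> \<bar>q $ i - z - q $ k\<bar>"
proof -
  define D where "D = (\<lambda>(i, k, z). \<bar>q $ i - z - q $ k\<bar>) ` (UNIV \<times> UNIV \<times> {-1, 0, 1}) - {0}"
  have "finite D" unfolding D_def by simp
  then have "\<exists>\<epsilon>>0. \<forall>d\<in>D. \<epsilon> \<le> d"
  proof (cases "D = {}")
    case False
    have "0 < d" if "d \<in> D" for d
      using that unfolding D_def by auto
    with \<open>finite D\<close> False show ?thesis
      by (intro exI[of _ "Min D"]) auto
  qed (auto intro: exI[of _ 1])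
  then obtain \<epsilon> where \<epsilon>: "0 < \<epsilon>" "\<And>d. d \<in> D \<Longrightarrow> \<epsilon> \<le> d" by blast
  have "\<epsilon> \<le> \<bar>q $ i - z - q $ k\<bar>" if "z \<in> {-1, 0, 1}" "q $ i - z \<noteq> q $ k" for i k z
    using that
    by (intro \<epsilon>(2)[unfolded D_def] DiffI image_eqI[of _ _ "(i, k, z)"]) auto
  with \<epsilon>(1) show ?thesis by (rule that)
qed

lemma tight_functionals:
  assumes const: "\<And>w x. tight_at w x \<Longrightarrow> c \<bullet> lowest_point q w x = \<kappa>"
    and off: "\<And>i. i \<notin> nodes C \<Longrightarrow> fst (snd c) $ i = 0"
    and arc: "(j, k) \<in> C"
  shows "fst (snd c) $ j = fst (snd c) $ k"
    and "(\<And>i. fst (snd c) $ i = 0) \<Longrightarrow> fst c = 0 \<and> snd (snd c) $ j = 0"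
proof -
  define t where "t = q $ k"
  obtain \<epsilon> where \<epsilon>: "0 < \<epsilon>"
    "\<And>i k z. z \<in> {-1, 0, 1} \<Longrightarrow> q $ i - z \<noteq> q $ k \<Longrightarrow> \<epsilon> \<le> \<bar>q $ i - z - q $ k\<bar>"
    using separation by blast
  \<comment> \<open>Here z = 1, where equality is excluded by
    \<open>q $ i - 1 < 0 \<le> q $ l\<close>.\<close>
  have far: "q $ i - q $ l \<le> 1 - \<epsilon>" for i l
    using \<epsilon>(2)[of 1 i l] q_less_1[of i] q_nonneg[of l] by auto
  have near: "\<epsilon> \<le> \<bar>q $ i - q $ l\<bar>" if "q $ i \<noteq> q $ l" for i l
    using \<epsilon>(2)[of 0 i l] that by auto
  \<comment> \<open>These are the two choices available at w = \<open>q $ k\<close>. They differ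
    only at j, the unique tail of an arc into k; \<open>a\<close> stays tight to the right of
    \<open>q $ k\<close> and \<open>b\<close> to the left.\<close>
  define a b where "a = tight_x t" and "b = (\<chi> i. a $ i + of_bool (i = j))"
  have aj: "real_of_int (a $ j) = - climb q j k"
    using arc by (simp add: a_def t_def tight_x_arc)
  have other: "q $ l \<noteq> t" if "(i, l) \<in> C" "i \<noteq> j" for i l
    using that arc head_unique inj_q in_nodes(2) unfolding t_def by (metis inj_onD)
  have tight_a: "tight_at w a" if w: "t \<le> w" "w \<le> t + \<epsilon>" for w
    unfolding a_def
  proof (rule tight_at_tight_x)
    show "q $ i - 1 \<le> w" "w \<le> q $ i + 1" for i
      using far[of i k] far[of k i] \<epsilon>(1) w unfolding t_def by linarith+
    show "w \<le> q $ l" if "t < q $ l" for l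
      using near[of l k] w that unfolding t_def by auto
  qed (use w in linarith)
  have tight_b: "tight_at w b" if w: "t - \<epsilon> \<le> w" "w \<le> t" for w
    unfolding tight_at_def
  proof (clarify, intro conjI)
    fix i l assume il: "(i, l) \<in> C"
    show "q $ i - 1 \<le> w" "w \<le> q $ i + 1"
      using far[of i k] far[of k i] \<epsilon>(1) w unfolding t_def by linarith+
    show "of_int (b $ i) = - climb q i l \<and> q $ l \<le> w \<or> of_int (b $ i) = 1 - climb q i l \<and> w \<le> q $ l"
    proof (cases "i = j")
      case True
      then have "l = k"
        using il arc tail_unique by blast
      with True w show ?thesis
        by (simp add: b_def aj t_def)
    next
      case False
      then have "real_of_int (b $ i) = of_bool (t < q $ l) - climb q i l"
        using il by (simp add: b_def a_def tight_x_arc)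
      moreover have "w \<le> q $ l" if "t < q $ l"
        using w that by linarith
      moreover have "q $ l \<le> w" if "\<not> t < q $ l"
        using near[of l k] other[OF il False] w that unfolding t_def by auto
      ultimately show ?thesis
        by (cases "t < q $ l") auto
    qed
  qed
  have a: "tight_at t a" "tight_at (t + \<epsilon>) a" and b: "tight_at t b" "tight_at (t - \<epsilon>) b"
    using tight_a tight_b \<epsilon>(1) by auto
  let ?m = "\<lambda>x w i. max 0 (q $ i - of_int (x $ i) - w)"
  \<comment> \<open>This compares the growth of y along the two segments. Only k, whose breakpoint
    is \<open>q $ k\<close>, and j, whose entry was switched, behave differently on them.\<close>
  have bracket: "fst (snd c) $ i * (?m a (t + \<epsilon>) i - ?m a t i - (?m b t i - ?m b (t - \<epsilon>) i)) =
      fst (snd c) $ i * \<epsilon> * (of_bool (i = k) - of_bool (i = j))" if "j \<noteq> k" for i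
  proof (cases "i \<in> nodes C")
    case i: True
    define d where "d = q $ i - of_int (a $ i) - t"
    have m: "?m a w i = max 0 (d + t - w)" "?m b w i = max 0 (d - of_bool (i = j) + t - w)" for w
      by (auto simp: d_def b_def)
    have qjk: "q $ j \<noteq> q $ k"
      using arc_cases[OF arc] \<open>j \<noteq> k\<close> by blast
    consider "i = k" | "i = j" | "i \<noteq> k" "i \<noteq> j" by blast
    then show ?thesis
    proof cases
      case 1
      have "q $ succ k \<noteq> q $ k"
        using arc_cases[OF succ_arc[of k]] head_unique[OF arc, of k] succ_arc[of k]
          in_nodes(2)[OF arc] \<open>j \<noteq> k\<close> by metis
      \<comment> \<open>Strict and weak comparison of \<open>q $ k\<close> with its successor's
        value coincide, so \<open>a $ k\<close> is 0.\<close>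
      then have "d = 0"
        using in_nodes(2)[OF arc] by (auto simp: d_def a_def tight_x_def t_def 1)
      then show ?thesis
        unfolding m using \<epsilon>(1) \<open>j \<noteq> k\<close> by (simp add: 1)
    next
      case 2
      have "d = q $ j + climb q j k - q $ k"
        by (simp add: d_def 2 aj t_def)
      \<comment> \<open>Thus \<open>y $ j\<close> has slope -1 in w along the segment of
        \<open>a\<close> and vanishes along that of \<open>b\<close>.\<close>
      then have "\<epsilon> \<le> d" "d \<le> 1 - \<epsilon>"
        using far[of j k] far[of k j] near[OF qjk] qjk by (auto simp: climb_def split: if_splits)
      then have "?m a (t + \<epsilon>) i - ?m a t i - (?m b t i - ?m b (t - \<epsilon>) i) = - \<epsilon>"
        unfolding m using \<epsilon>(1) by (simp add: 2 max_def)
      then show ?thesis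
        unfolding \<open>_ = - \<epsilon>\<close> using \<open>j \<noteq> k\<close> by (simp add: 2)
    next
      case 3
      have "q $ i \<noteq> q $ k"
        using inj_onD[OF inj_q _ i in_nodes(2)[OF arc]] 3 by blast
      moreover have "of_int (a $ i) \<in> {-1, 0, 1 :: real}"
        using tight_x_range[of t i] unfolding a_def by auto
      ultimately have "q $ i - of_int (a $ i) \<noteq> q $ k"
        using q_nonneg[of i] q_nonneg[of k] q_less_1[of i] q_less_1[of k] by auto
      then have "\<epsilon> \<le> \<bar>d\<bar>"
        using \<epsilon>(2)[OF \<open>of_int (a $ i) \<in> _\<close>] by (simp add: d_def t_def)
      then show ?thesis
        unfolding m using 3 \<epsilon>(1) by (auto simp: max_def)
    qed
  qed (simp add: off)
  show "fst (snd c) $ j = fst (snd c) $ k"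
  proof (cases "j = k")
    case False
    \<comment> \<open>Both segments have length \<epsilon>, so the coefficient of w drops out; x is
      fixed on each of them.\<close>
    have "0 = (c \<bullet> lowest_point q (t + \<epsilon>) a - c \<bullet> lowest_point q t a)
        - (c \<bullet> lowest_point q t b - c \<bullet> lowest_point q (t - \<epsilon>) b)"
      using const a b by simp
    also have "\<dots> = (\<Sum>i\<in>UNIV. fst (snd c) $ i *
        (?m a (t + \<epsilon>) i - ?m a t i - (?m b t i - ?m b (t - \<epsilon>) i)))"
      unfolding lowest_point_inner right_diff_distrib sum_subtractf
      by (simp add: right_diff_distrib distrib_left)
    also have "\<dots> = (\<Sum>i\<in>UNIV. fst (snd c) $ i * \<epsilon> * (of_bool (i = k) - of_bool (i = j)))"
      by (simp only: bracket[OF False])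
    also have "\<dots> = fst (snd c) $ k * \<epsilon> - fst (snd c) $ j * \<epsilon>"
      by (simp add: right_diff_distrib sum_subtractf)
    finally show ?thesis
      using \<epsilon>(1) by simp
  qed simp
  show "fst c = 0 \<and> snd (snd c) $ j = 0" if zero: "\<And>i. fst (snd c) $ i = 0"
  proof
    have "c \<bullet> lowest_point q (t + \<epsilon>) a = c \<bullet> lowest_point q t a"
      using const a by simp
    then show "fst c = 0"
      using \<epsilon>(1) by (simp add: lowest_point_inner zero algebra_simps)
    have "c \<bullet> lowest_point q t b = c \<bullet> lowest_point q t a"
      using const a b by simp
    then show "snd (snd c) $ j = 0"
      by (simp add: lowest_point_inner zero b_def distrib_left sum.distrib)
  qed
qed

lemma ray_in_cmix:
  assumes "v \<in> cmix q"
  shows "v + (0, axis i 1, 0) \<in> cmix q" "v + (0, 0, axis i 1) \<in> cmix q"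
proof -
  obtain w y x where v: "v = (w, y, x)"
    by (cases v)
  have axis: "0 \<le> (axis i 1 :: real ^ 'n) $ l" "(axis i 1 :: real ^ 'n) $ l \<in> \<int>" for l
    by (auto simp: axis_def)
  have "q $ l \<le> w + x $ l + y $ l" for l
    using assms by (auto simp: v cmix_def)
  with axis(1) have "q $ l \<le> w + x $ l + (y $ l + axis i 1 $ l)" "q $ l \<le> w + (x $ l + axis i 1 $ l) + y $ l" for l
    by (smt (verit))+
  with assms axis show
    "v + (0, axis i 1, 0) \<in> cmix q" "v + (0, 0, axis i 1) \<in> cmix q"
    by (auto simp: v cmix_def)
qed

lemma facet_defining_cycle_ineq: "facet_defining (cycle_ineq q C) (convex hull (cmix q))"
proof -
  define v0 where "v0 = lowest_point q 0 (tight_x 0)"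
  have "tight_at 0 (tight_x 0)"
    using q_nonneg q_less_1 by (intro tight_at_tight_x) (auto simp: less_imp_le)
  then have v0: "v0 \<in> cmix q" "normal \<bullet> v0 = const"
    using cyc_lowest_point cyc_eq_inner lowest_point_in_cmix unfolding v0_def by auto
  obtain i0 where i0: "i0 \<in> nodes C"
    using nonempty unfolding nodes_eq by blast
  have "(convex hull cmix q \<inter> {v. normal \<bullet> v = const}) facet_of (convex hull cmix q)"
  proof (rule facet_of_hullI[where vt = v0 and vs = "v0 + (0, axis i0 1, 0)"])
    show "const \<le> normal \<bullet> v" if "v \<in> cmix q" for v
      using cyc_nonneg[OF that] by (simp add: cyc_eq_inner)
    show "v0 + (0, axis i0 1, 0) \<in> cmix q"
      using v0(1) by (rule ray_in_cmix)
    show "normal \<bullet> (v0 + (0, axis i0 1, 0)) \<noteq> const"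
      using i0 v0(2) by (simp add: inner_add_right normal_def inner_axis indicator_vec_def)
    fix c assume c: "\<And>v. v \<in> cmix q \<Longrightarrow> normal \<bullet> v = const \<Longrightarrow> c \<bullet> v = c \<bullet> v0"
    \<comment> \<open>Outside the cycle \<open>normal\<close> vanishes, so both rays keep the point
      tight.\<close>
    have off: "fst (snd c) $ i = 0" "snd (snd c) $ i = 0" if "i \<notin> nodes C" for i
    proof -
      have "c \<bullet> (v0 + (0, axis i 1, 0)) = c \<bullet> v0" "c \<bullet> (v0 + (0, 0, axis i 1)) = c \<bullet> v0"
        using that v0(2)
        by (intro c ray_in_cmix v0(1);
            simp add: inner_add_right normal_def inner_axis indicator_vec_def coef_x_def)+
      then show "fst (snd c) $ i = 0" "snd (snd c) $ i = 0"
        by (auto simp: inner_add_right inner_prod_def inner_axis)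
    qed
    have tight: "c \<bullet> lowest_point q w x = c \<bullet> v0" if "tight_at w x" for w x
      using cyc_lowest_point[OF that] by (intro c lowest_point_in_cmix) (simp add: cyc_eq_inner)
    \<comment> \<open>\<open>l\<close> is the common coefficient of y on the cycle; subtracting
      \<open>l *\<^sub>R normal\<close> removes the y-part, and the second claim of
      \<open>tight_functionals\<close> then applies to the rest.\<close>
    define l c' where "l = fst (snd c) $ i0" and "c' = c - l *\<^sub>R normal"
    have "fst (snd c) $ i = l" if "i \<in> nodes C" for i
      unfolding l_def
      by (rule const_along[of "\<lambda>i. fst (snd c) $ i"])
         (use tight_functionals(1)[OF tight off(1)] that i0 in \<open>simp_all add: nodes_eq\<close>)
    then have zero: "fst (snd c') $ i = 0" for i
      using off by (cases "i \<in> nodes C") (auto simp: c'_def normal_def indicator_vec_def)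
    have "c' \<bullet> lowest_point q w x = c' \<bullet> v0" if "tight_at w x" for w x
      using tight[OF that] cyc_lowest_point[OF that] v0
      by (simp add: c'_def inner_diff_left cyc_eq_inner)
    from tight_functionals(2)[OF this zero _ zero]
    have arcs: "fst c' = 0 \<and> snd (snd c') $ j = 0" if "(j, k) \<in> C" for j k
      using that by blast
    have "fst c' = 0"
      using nonempty arcs by auto
    moreover have "snd (snd c') $ i = 0" for i
      using off arcs[OF succ_arc] by (cases "i \<in> nodes C") (auto simp: c'_def normal_def coef_x_def)
    ultimately have "c' = 0"
      using zero by (simp add: prod_eq_iff vec_eq_iff)
    then show "\<exists>l. c = l *\<^sub>R normal"
      unfolding c'_def by auto
  qed (use v0 in auto)
  moreover have "normal \<bullet> v \<ge> const" if "v \<in> convex hull cmix q" for v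
  proof -
    have "convex hull cmix q \<subseteq> {v. const \<le> normal \<bullet> v}"
      using cyc_nonneg by (intro hull_minimal convex_halfspace_ge) (force simp: cyc_eq_inner)
    with that show ?thesis by blast
  qed
  moreover have "fst (cycle_ineq q C) v = normal \<bullet> v - const" "snd (cycle_ineq q C) v = 0" for v
    using cyc_eq_inner[of v] by (simp_all add: cycle_ineq_def cyc_def)
  ultimately show ?thesis
    unfolding facet_defining_def by (simp add: Int_def)
qed

section \<open>Values of F and the comparison with an MISEPI\<close>

text \<open>Each candidate in the minimum is \<open>lin\<close> plus the value of \<open>cyc\<close>
  at the lowest point with w = \<open>h_fn q j x\<close>. Validity bounds it below by
  \<open>lin\<close>, and the assumption supplies equality.\<close>

lemma F_fn_eq_lin:
  assumes "cyc (lowest_point q (h_fn q l x) x) = 0"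
  shows "F_fn q coef_w (indicator_vec (nodes C)) x = lin (\<chi> i. of_int (x $ i))"
proof -
  have val: "coef_w * h_fn q j x + (\<Sum>i\<in>UNIV. indicator_vec (nodes C) $ i * max 0 (h_fn q i x - h_fn q j x))
      = cyc (lowest_point q (h_fn q j x) x) + lin (\<chi> i. of_int (x $ i))" for j
    unfolding lowest_point_def cyc_eq_lin by (simp add: h_fn_def)
  show ?thesis
    unfolding F_fn_def val
  proof (rule Min_eqI)
    show "lin (\<chi> i. of_int (x $ i)) \<in> range (\<lambda>j. cyc (lowest_point q (h_fn q j x) x) + lin (\<chi> i. of_int (x $ i)))"
      using assms by (intro range_eqI[of _ _ l]) simp
  qed (auto intro!: cyc_nonneg lowest_point_in_cmix)
qed

lemma same_ineq_misepi:
  assumes \<delta>: "permutation_of_N \<delta>"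
    and tight: "\<And>i. i \<le> CARD('n) \<Longrightarrow>
      \<exists>l. cyc (lowest_point q (h_fn q l (partial_point p \<delta> i)) (partial_point p \<delta> i)) = 0"
  shows "same_ineq (cycle_ineq q C) (misepi q coef_w (indicator_vec (nodes C)) p \<delta>)"
proof -
  let ?F = "\<lambda>i. F_fn q coef_w (indicator_vec (nodes C)) (partial_point p \<delta> i)"
  have F: "?F i = lin (\<chi> l. of_int (partial_point p \<delta> i $ l))" if "i \<le> CARD('n)" for i
    using tight[OF that] F_fn_eq_lin by blast
  \<comment> \<open>Consecutive partial points differ by the unit vector of
    \<open>\<delta> i\<close>, so the increment of the affine function is a coefficient independent
    of the order.\<close>
  have diff: "?F i - ?F (i - 1) = coef_x (\<delta> i)" if "i \<in> {1..CARD('n)}" for i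
  proof -
    define i' where "i' = i - 1"
    have i: "i = Suc i'"
      using that by (simp add: i'_def)
    have "partial_point p \<delta> i $ l = partial_point p \<delta> i' $ l + of_bool (l = \<delta> i)" for l
      by (simp add: partial_point_def indicator_vec_def i)
    then show ?thesis
      using that unfolding i by (simp add: F lin_def distrib_left sum.distrib)
  qed
  have "snd (misepi q coef_w (indicator_vec (nodes C)) p \<delta>) (w, y, x) = lin x" for w y x
  proof -
    have "(\<Sum>i = 1..CARD('n). (?F i - ?F (i - 1)) * (x $ \<delta> i - of_int (p $ \<delta> i))) =
        (\<Sum>i = 1..CARD('n). coef_x (\<delta> i) * (x $ \<delta> i - of_int (p $ \<delta> i)))"
      by (rule sum.cong) (simp_all only: diff)
    also have "\<dots> = (\<Sum>l\<in>UNIV. coef_x l * (x $ l - of_int (p $ l)))"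
      using \<delta> unfolding permutation_of_N_def by (rule sum.reindex_bij_betw)
    finally have "(\<Sum>i = 1..CARD('n). (?F i - ?F (i - 1)) * (x $ \<delta> i - of_int (p $ \<delta> i))) =
        (\<Sum>l\<in>UNIV. coef_x l * (x $ l - of_int (p $ l)))" .
    moreover have "?F 0 = lin (\<chi> l. of_int (p $ l))"
      by (simp add: F) (simp add: partial_point_def)
    ultimately show ?thesis
      unfolding misepi_def snd_conv prod.case
      by (simp only:) (simp add: lin_def right_diff_distrib sum_subtractf)
  qed
  then show ?thesis
    unfolding same_ineq_def
    by (auto simp: cycle_ineq_def cyc_eq_lin[unfolded cyc_def] misepi_def)
qed

lemma misepi_weights_cycle: "misepi_weights coef_w (indicator_vec (nodes C))"
proof -
  have "coef_w \<le> (\<Sum>(j, k)\<in>C. 1)"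
    unfolding coef_w_def by (intro sum_mono) (auto simp: climb_def)
  also have "\<dots> = (\<Sum>i\<in>UNIV. indicator_vec (nodes C) $ i)"
    unfolding sum_tails by (rule sum.mono_neutral_cong_left) (auto simp: indicator_vec_def)
  finally show ?thesis
    by (auto simp: misepi_weights_def coef_w_def climb_def indicator_vec_def intro!: sum_nonneg)
qed

section \<open>Self-loops\<close>

lemma self_loop_misepi:
  assumes "C = {(j, j)}" "permutation_of_N \<delta>"
  shows "misepi_weights 1 (indicator_vec {j})"
    "same_ineq (cycle_ineq q C) (misepi q 1 (indicator_vec {j}) p \<delta>)"
proof -
  have *: "coef_w = 1" "nodes C = {j}"
    unfolding coef_w_def nodes_def unfolding assms(1) by (auto simp: climb_def)
  show "misepi_weights 1 (indicator_vec {j})"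
    using misepi_weights_cycle unfolding * .
  \<comment> \<open>At w = \<open>q $ j - x $ j\<close> the component \<open>y $ j\<close> is 0,
    whatever x is; hence p and \<delta> are arbitrary.\<close>
  have "cyc (lowest_point q (h_fn q j x) x) = 0" for x
    unfolding cyc_def unfolding assms(1) by (simp add: phi_def lowest_point_def h_fn_def)
  then show "same_ineq (cycle_ineq q C) (misepi q 1 (indicator_vec {j}) p \<delta>)"
    using same_ineq_misepi[OF assms(2)] unfolding * by blast
qed

section \<open>Cycles with at least two nodes\<close>

lemma two_nodes_iff: "2 \<le> card (nodes C) \<longleftrightarrow> (\<nexists>j. C = {(j, j)})"
proof
  assume "2 \<le> card (nodes C)"
  then show "\<nexists>j. C = {(j, j)}"
    by (auto simp: nodes_def)
next
  assume *: "\<nexists>j. C = {(j, j)}"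
  obtain j k where jk: "(j, k) \<in> C"
    using nonempty by auto
  then have "j \<noteq> k"
    using * loop_imp_singleton by blast
  then have "card {j, k} = 2" by simp
  moreover have "card {j, k} \<le> card (nodes C)"
    using in_nodes[OF jk] by (intro card_mono) auto
  ultimately show "2 \<le> card (nodes C)" by simp
qed

lemma in_nbr_eq: "(j, k) \<in> C \<Longrightarrow> in_nbr C k = j"
  unfolding in_nbr_def using head_unique by blast

lemma in_nbr_arc: "k \<in> nodes C \<Longrightarrow> (in_nbr C k, k) \<in> C"
  unfolding nodes_eq heads_eq_tails[symmetric] using in_nbr_eq by fastforce

lemma ex_cycle_permutation: "\<exists>\<delta>. cycle_permutation q C \<delta>"
proof -
  let ?m = "card (nodes C)" and ?f = "\<lambda>i. - q $ i"
  \<comment> \<open>Negated values turn increasing sorting into the decreasing labelling; the later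
    \<open>i - 1\<close> converts labels from 1 into list positions from 0.\<close>
  define L where "L = sorted_list_of_set (?f ` nodes C)"
  have inj: "inj_on ?f (nodes C)"
    using inj_q by (auto simp: inj_on_def)
  have L: "length L = ?m" "set L = ?f ` nodes C" "distinct L" "sorted_wrt (<) L"
    unfolding L_def using card_image[OF inj] by auto
  define \<nu> where "\<nu> i = the_inv_into (nodes C) ?f (L ! (i - 1))" for i
  have "bij_betw (\<lambda>i. i - 1) {1..?m} {..<length L}"
    unfolding L(1) by (rule bij_betw_byWitness[of _ Suc]) auto
  then have "bij_betw (the_inv_into (nodes C) ?f \<circ> ((!) L \<circ> (\<lambda>i. i - 1))) {1..?m} (nodes C)"
    using bij_betw_nth[OF L(3) refl L(2)[symmetric]]
      bij_betw_the_inv_into[OF inj_on_imp_bij_betw[OF inj]]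
    by (blast intro: bij_betw_trans)
  then have \<nu>: "bij_betw \<nu> {1..?m} (nodes C)"
    by (simp add: \<nu>_def[abs_def] comp_def)
  have nth: "- q $ \<nu> a = L ! (a - 1)" if "a \<in> {1..?m}" for a
    unfolding \<nu>_def using that L by (intro f_the_inv_into_f[OF inj]) auto
  have dec: "q $ \<nu> b < q $ \<nu> a" if "a \<in> {1..?m}" "b \<in> {1..?m}" "a < b" for a b
  proof -
    have "L ! (a - 1) < L ! (b - 1)"
      using that L(1) by (intro sorted_wrt_nth_less[OF L(4)]) auto
    then show ?thesis
      using nth[of a] nth[of b] that by simp
  qed
  have "bij_betw (in_nbr C) (nodes C) (nodes C)"
  proof (rule bij_betw_byWitness[of _ succ])
    show "in_nbr C ` nodes C \<subseteq> nodes C" "succ ` nodes C \<subseteq> nodes C"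
      using in_nodes in_nbr_arc succ_arc by blast+
  qed (use in_nbr_arc in_nbr_eq succ_arc succ_eq in auto)
  then have inner: "bij_betw (in_nbr C \<circ> \<nu>) {1..?m} (nodes C)"
    using \<nu> by (rule bij_betw_trans[rotated])
  have le: "?m \<le> CARD('n)"
    by (simp add: card_mono)
  obtain \<rho> where outer: "bij_betw \<rho> {?m<..CARD('n)} (UNIV - nodes C)"
    using finite_same_card_bij[of "{?m<..CARD('n)}" "UNIV - nodes C"]
    by (auto simp: card_Diff_subset)
  have "bij_betw (\<lambda>i. if i \<in> {1..?m} then (in_nbr C \<circ> \<nu>) i else \<rho> i)
      ({1..?m} \<union> {?m<..CARD('n)}) (nodes C \<union> (UNIV - nodes C))"
    by (rule bij_betw_disjoint_Un[OF inner outer]) auto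
  moreover have "{1..?m} \<union> {?m<..CARD('n)} = {1..CARD('n)}"
    using le by auto
  ultimately have "permutation_of_N (\<lambda>i. if i \<in> {1..?m} then (in_nbr C \<circ> \<nu>) i else \<rho> i)"
    by (simp add: permutation_of_N_def)
  then show ?thesis
    unfolding cycle_permutation_def decreasing_labelling_def using \<nu> dec
    by (intro exI[of _ "\<lambda>i. if i \<in> {1..?m} then (in_nbr C \<circ> \<nu>) i else \<rho> i"]
        conjI exI[of _ \<nu>]) auto
qed

lemma partial_point_nth:
  fixes \<delta> :: "nat \<Rightarrow> 'n"
  assumes "permutation_of_N \<delta>" "b \<in> {1..CARD('n)}" "i \<le> CARD('n)"
  shows "partial_point p \<delta> i $ \<delta> b = p $ \<delta> b + of_bool (b \<le> i)"
proof -
  have "(\<Sum>j = 1..i. indicator_vec {\<delta> j} $ \<delta> b) = (\<Sum>j = 1..i. of_bool (j = b) :: int)"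
    using assms unfolding permutation_of_N_def bij_betw_def
    by (intro sum.cong) (auto simp: indicator_vec_def dest: inj_onD)
  also have "\<dots> = of_bool (b \<le> i)"
    using assms(2) by (simp add: sum.delta of_bool_def)
  finally show ?thesis
    by (simp add: partial_point_def)
qed

lemma no_loop:
  assumes "2 \<le> card (nodes C)" "(j, k) \<in> C"
  shows "j \<noteq> k"
  using assms loop_imp_singleton unfolding two_nodes_iff by blast

lemma ascent_nodes_iff:
  assumes "2 \<le> card (nodes C)" "(j, k) \<in> C"
  shows "j \<in> ascent_nodes q C \<longleftrightarrow> q $ j \<le> q $ k"
proof -
  have "j \<in> ascent_nodes q C \<longleftrightarrow> q $ j < q $ k"
    using tail_unique[OF assms(2)] in_nodes(1)[OF assms(2)] assms(2)
    unfolding ascent_nodes_def by blast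
  then show ?thesis
    using arc_cases[OF assms(2)] no_loop[OF assms] by auto
qed

lemma coef_w_eq_card:
  assumes "2 \<le> card (nodes C)"
  shows "coef_w = card (ascent_nodes q C)"
proof -
  have "coef_w = (\<Sum>(j, k)\<in>C. of_bool (j \<in> ascent_nodes q C))"
    unfolding coef_w_def
    by (intro sum.cong) (auto simp: climb_def ascent_nodes_iff[OF assms])
  also have "\<dots> = (\<Sum>j\<in>ascent_nodes q C. 1)"
    unfolding sum_tails by (rule sum.mono_neutral_cong_right) (auto simp: ascent_nodes_def)
  finally show ?thesis by simp
qed

text \<open>After i steps exactly the tails of the arcs into \<open>\<nu> 1\<close>, ...,
  \<open>\<nu> i\<close> have been raised (within the cycle), which is the tight choice for w
  between two consecutive values of q.\<close>

lemma cycle_misepi: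
  assumes two: "2 \<le> card (nodes C)"
    and p: "\<forall>j\<in>ascent_nodes q C. p $ j = -1" "\<forall>j\<in>nodes C - ascent_nodes q C. p $ j = 0"
    and \<delta>: "cycle_permutation q C \<delta>"
  shows "same_ineq (cycle_ineq q C)
    (misepi q (card (ascent_nodes q C)) (indicator_vec (nodes C)) p \<delta>)"
proof -
  let ?m = "card (nodes C)"
  note noloop = no_loop[OF two] and ascent = ascent_nodes_iff[OF two]
  obtain \<nu> where perm: "permutation_of_N \<delta>" and \<nu>: "bij_betw \<nu> {1..?m} (nodes C)"
    and dec: "\<And>a b. a \<in> {1..?m} \<Longrightarrow> b \<in> {1..?m} \<Longrightarrow> a < b \<Longrightarrow> q $ \<nu> b < q $ \<nu> a"
    and \<delta>\<nu>: "\<And>i. i \<in> {1..?m} \<Longrightarrow> \<delta> i = in_nbr C (\<nu> i)"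
    using \<delta> unfolding cycle_permutation_def decreasing_labelling_def by blast
  have less_iff: "q $ \<nu> b < q $ \<nu> a \<longleftrightarrow> a < b" if "a \<in> {1..?m}" "b \<in> {1..?m}" for a b
    using dec[of a b] dec[of b a] that by (cases a b rule: linorder_cases) auto
  have le: "?m \<le> CARD('n)"
    by (simp add: card_mono)
  have step: "\<exists>b\<in>{1..?m}. \<nu> b = k \<and>
      (\<forall>i\<le>CARD('n). real_of_int (partial_point p \<delta> i $ j) = of_bool (b \<le> i) - climb q j k)"
    if jk: "(j, k) \<in> C" for j k
  proof -
    obtain b where b: "b \<in> {1..?m}" "\<nu> b = k"
      using \<nu> in_nodes(2)[OF jk] unfolding bij_betw_def by force
    have "\<delta> b = j"
      using \<delta>\<nu>[OF b(1)] in_nbr_eq[OF jk] b(2) by simp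
    moreover have "p $ j = - of_bool (q $ j \<le> q $ k)"
      using p ascent[OF jk] in_nodes[OF jk] by auto
    ultimately have "real_of_int (partial_point p \<delta> i $ j) = of_bool (b \<le> i) - climb q j k"
      if "i \<le> CARD('n)" for i
      using partial_point_nth[OF perm _ that, of b p] b le by (simp add: climb_def)
    with b show ?thesis by blast
  qed
  have "\<exists>l. cyc (lowest_point q (h_fn q l (partial_point p \<delta> i)) (partial_point p \<delta> i)) = 0"
    if i: "i \<le> CARD('n)" for i
  proof -
    let ?x = "partial_point p \<delta> i"
    \<comment> \<open>Clamping to the labels: i = 0 uses the largest value, and steps beyond the
      cycle use the smallest.\<close>
    define a where "a = min ?m (max 1 i)"
    have a: "a \<in> {1..?m}"
      using two by (auto simp: a_def)
    have "tight_at (q $ \<nu> a) ?x"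
      unfolding tight_at_def
    proof (clarify, intro conjI)
      fix j k assume jk: "(j, k) \<in> C"
      show "q $ j - 1 \<le> q $ \<nu> a" "q $ \<nu> a \<le> q $ j + 1"
        using q_nonneg[of j] q_nonneg[of "\<nu> a"] q_less_1[of j] q_less_1[of "\<nu> a"] by linarith+
      obtain b where b: "b \<in> {1..?m}" "\<nu> b = k"
        and x: "real_of_int (?x $ j) = of_bool (b \<le> i) - climb q j k"
        using step[OF jk] i by blast
      have "q $ \<nu> a \<le> q $ k" if "b \<le> i"
        using less_iff[OF a b(1)] that b by (auto simp: a_def)
      moreover have "q $ k \<le> q $ \<nu> a" if "\<not> b \<le> i"
        using less_iff[OF b(1) a] that b by (auto simp: a_def)
      ultimately show "real_of_int (?x $ j) = - climb q j k \<and> q $ k \<le> q $ \<nu> a \<or>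
          real_of_int (?x $ j) = 1 - climb q j k \<and> q $ \<nu> a \<le> q $ k"
        using x by auto
    qed
    moreover have "h_fn q (\<nu> a) ?x = q $ \<nu> a"
    proof -
      have arc: "(\<nu> a, succ (\<nu> a)) \<in> C"
        using \<nu> a by (intro succ_arc) (auto simp: bij_betw_def)
      obtain b where b: "b \<in> {1..?m}" "\<nu> b = succ (\<nu> a)"
        and x: "real_of_int (?x $ \<nu> a) = of_bool (b \<le> i) - climb q (\<nu> a) (\<nu> b)"
        using step[OF arc] i by metis
      \<comment> \<open>For \<open>b \<noteq> a\<close> the conditions \<open>b \<le> i\<close> and
        \<open>b < a\<close> agree, so the raise cancels \<open>climb\<close> and the entry at
        \<open>\<nu> a\<close> is 0. This makes w one of the values \<open>h_fn\<close> tested by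
        F.\<close>
      have "b \<noteq> a"
        using noloop[OF arc] b(2) by auto
      moreover have "q $ \<nu> a \<noteq> q $ \<nu> b"
        using arc_cases[OF arc] noloop[OF arc] b(2) by auto
      then have "climb q (\<nu> a) (\<nu> b) = of_bool (b < a)"
        using less_iff[OF b(1) a] by (simp add: climb_def order_le_less)
      ultimately have "real_of_int (?x $ \<nu> a) = 0"
        using x b(1) by (auto simp: a_def)
      then show ?thesis
        by (simp add: h_fn_def)
    qed
    ultimately show ?thesis
      using cyc_lowest_point by metis
  qed
  from same_ineq_misepi[OF perm this] show ?thesis
    unfolding coef_w_eq_card[OF two] .
qed

lemma cycle_ineq_is_misepi: "\<exists>a. is_misepi q a \<and> same_ineq (cycle_ineq q C) a"
proof -
  obtain \<delta> where \<delta>: "cycle_permutation q C \<delta>"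
    using ex_cycle_permutation by blast
  then have perm: "permutation_of_N \<delta>"
    unfolding cycle_permutation_def by blast
  show "\<exists>a. is_misepi q a \<and> same_ineq (cycle_ineq q C) a"
  proof (cases "2 \<le> card (nodes C)")
    case True
    let ?p = "(\<chi> j. - of_bool (j \<in> ascent_nodes q C)) :: int ^ 'n"
    show ?thesis
      using cycle_misepi[OF True _ _ \<delta>, where p = ?p] misepi_weights_cycle perm
      unfolding is_misepi_def coef_w_eq_card[OF True] by fastforce
  next
    case False
    then obtain j where "C = {(j, j)}"
      unfolding two_nodes_iff by blast
    then show ?thesis
      using self_loop_misepi(1)[of j \<delta>] self_loop_misepi(2)[of j \<delta> 0] perm unfolding is_misepi_def by blast
  qed
qed

end

theorem proposition5p38:
  fixes q :: "real ^ 'n::{finite,linorder}" and C :: "('n \<times> 'n) set"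
  assumes "\<forall>i. 0 \<le> q $ i" and "\<forall>i. q $ i < 1" and "\<forall>i j. i \<le> j \<longrightarrow> q $ i \<ge> q $ j"
    and "elementary_cycle q C"
    and "inj_on (\<lambda>i. q $ i) (nodes C)"
  shows "facet_defining (cycle_ineq q C) (convex hull (cmix q)) \<and>
    (\<exists>a. is_misepi q a \<and> same_ineq (cycle_ineq q C) a) \<and>
    (\<forall>j p \<delta>. C = {(j, j)} \<and> permutation_of_N \<delta> \<longrightarrow>
       misepi_weights 1 (indicator_vec {j}) \<and>
       same_ineq (cycle_ineq q C) (misepi q 1 (indicator_vec {j}) p \<delta>)) \<and>
    (card (nodes C) \<ge> 2 \<longrightarrow>
       misepi_weights (card (ascent_nodes q C)) (indicator_vec (nodes C)) \<and>
       (\<exists>\<delta>. cycle_permutation q C \<delta>) \<and>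
       (\<forall>p \<delta>.
          (\<forall>j \<in> ascent_nodes q C. p $ j = -1) \<and>
          (\<forall>j \<in> nodes C - ascent_nodes q C. p $ j = 0) \<and>
          (\<forall>j \<in> UNIV - nodes C. p $ j = 2) \<and>
          cycle_permutation q C \<delta> \<longrightarrow>
          same_ineq (cycle_ineq q C)
            (misepi q (card (ascent_nodes q C)) (indicator_vec (nodes C)) p \<delta>)))"
proof -
  interpret node_cycle q C
    using assms by (intro elementary_cycle_node_cycle) auto
  show ?thesis
    using facet_defining_cycle_ineq cycle_ineq_is_misepi self_loop_misepi misepi_weights_cycle ex_cycle_permutation
      cycle_misepi coef_w_eq_card by (intro conjI allI impI) (metis | blast)+
qed

end
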